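(* Let $F$ be a field with $\operatorname{Char}(F)\neq 2$ and let $R$ be a simple associative unital $F$-algebra. Let $*$ be an involution on $R$ of the first kind with set of symmetric elements $S$ and set of skew-symmetric elements $K$, and assume $S\subsetneq R$. Assume that $K$ is not a skew-commutative set. Then $R=K+KSK$.
   Context: $S=\{r\in R: r^*=r\}$ and $K=\{r\in R: r^*=-r\}$. The involution $*$ is of the first kind if $Z(R)\subseteq S$, where $Z(R)$ is the center of $R$. A subset $A\subseteq R$ is a skew-commutative set if $xy=-yx$ for all $x,y\in A$. $KSK$ denotes the $F$-subspace of $R$ generated by all products $asb$ with $a,b\in K$, $s\in S$. *)

theory Defs
  imports
    "HOL-Computational_Algebra.Computational_Algebra"
    "HOL-Library.Set_Algebras"
begin

text \<open>
  The underlying ring of the algebra is a type \<open>'r\<close> of class \<open>ring_1\<close>, so \<open>R\<close> is \<open>UNIV\<close>.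
  The base field acts through an explicit scalar multiplication, as in the locale
  \<open>vector_space\<close>.
\<close>

locale unital_algebra = vector_space scale
  for scale :: "'f::field \<Rightarrow> 'r::ring_1 \<Rightarrow> 'r" +
  assumes scale_mult_left: "scale c x * y = scale c (x * y)"
    and scale_mult_right: "x * scale c y = scale c (x * y)"

definition two_sided_ideal :: "'r::ring_1 set \<Rightarrow> bool" where
  "two_sided_ideal I \<longleftrightarrow>
     0 \<in> I \<and> (\<forall>x\<in>I. \<forall>y\<in>I. x - y \<in> I) \<and> (\<forall>r. \<forall>x\<in>I. r * x \<in> I \<and> x * r \<in> I)"

text \<open>
  The class \<open>ring_1\<close> contains the axiom \<open>0 \<noteq> 1\<close>, so the zero ring is excluded. Since the
  algebra is unital, the two-sided ideals of the ring are automatically \<open>F\<close>-subspaces: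
  simplicity as a ring and as an algebra coincide.
\<close>

definition simple_ring :: "'r::ring_1 itself \<Rightarrow> bool" where
  "simple_ring _ \<longleftrightarrow> (\<forall>I :: 'r set. two_sided_ideal I \<longrightarrow> I = {0} \<or> I = UNIV)"

text \<open>
  No compatibility of the involution with the scalars is imposed; for an involution of the
  first kind, \<open>F\<close>-linearity follows from \<open>F\<cdot>1 \<subseteq> Z(R) \<subseteq> S\<close>.
\<close>

definition ring_involution :: "('r::ring_1 \<Rightarrow> 'r) \<Rightarrow> bool" where
  "ring_involution star \<longleftrightarrow>
     (\<forall>x y. star (x + y) = star x + star y) \<and>
     (\<forall>x y. star (x * y) = star y * star x) \<and>
     (\<forall>x. star (star x) = x)"

definition ring_center :: "'r::ring_1 set" where
  "ring_center = {z. \<forall>r. z * r = r * z}"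

definition sym_elems :: "('r::ring_1 \<Rightarrow> 'r) \<Rightarrow> 'r set" where
  "sym_elems star = {r. star r = r}"

definition skew_elems :: "('r::ring_1 \<Rightarrow> 'r) \<Rightarrow> 'r set" where
  "skew_elems star = {r. star r = - r}"

definition first_kind :: "('r::ring_1 \<Rightarrow> 'r) \<Rightarrow> bool" where
  "first_kind star \<longleftrightarrow> ring_center \<subseteq> sym_elems star"

definition skew_commutative_set :: "'r::ring_1 set \<Rightarrow> bool" where
  "skew_commutative_set A \<longleftrightarrow> (\<forall>x\<in>A. \<forall>y\<in>A. x * y = - (y * x))"

definition (in unital_algebra) KSK :: "('r \<Rightarrow> 'r) \<Rightarrow> 'r set" where
  "KSK star =
     span {a * s * b | a s b. a \<in> skew_elems star \<and> s \<in> sym_elems star \<and> b \<in> skew_elems star}"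

end

theory Submission
  imports Defs
begin

text \<open>
  Put \<open>T = K + KSK\<close>, an \<open>F\<close>-subspace of \<open>R\<close>. Since \<open>K\<close> is closed under \<open>k \<mapsto> sk + ks\<close> and
  \<open>k \<mapsto> [l, k]\<close>, and \<open>S\<close> under \<open>t \<mapsto> st + ts\<close> and \<open>t \<mapsto> [l, t]\<close>, for \<open>s \<in> S\<close>, \<open>l \<in> K\<close>, rewriting
  products \<open>asb\<close> shows that \<open>T\<close> is closed under the Jordan products \<open>x \<mapsto> sx + xs\<close> and the
  commutators \<open>x \<mapsto> [l, x]\<close>. These two closure properties, together with \<open>lSl \<subseteq> KSK\<close>, give
  \<open>r T r\<^sup>* \<subseteq> T\<close> for every \<open>r = s + l\<close> (lemma \<open>conj_closed\<close>).
  The hypothesis on the characteristic enters through division by 2: it gives \<open>R = S + K\<close>, and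
  \<open>x \<in> T\<close> whenever \<open>2x \<in> T\<close>.

  Polarising, \<open>r u t + (r u t)\<^sup>* \<in> T\<close> for symmetric \<open>u \<in> T\<close> and all \<open>r\<close>, \<open>t\<close>. As
  \<open>r u t - (r u t)\<^sup>*\<close> is skew, it lies in \<open>T\<close> as well, so \<open>T\<close> contains the whole two-sided ideal
  generated by \<open>u\<close> (lemma \<open>ideal_of_symmetric\<close>). Because \<open>K\<close> is not skew-commutative, some
  \<open>u = ab + ba\<close> with \<open>a, b \<in> K\<close> is nonzero. It is symmetric and lies in \<open>KSK\<close> (take \<open>s = 1\<close>), so
  simplicity of \<open>R\<close> yields \<open>T = R\<close>.
\<close>

section \<open>Involutions of the first kind\<close>

locale first_kind_algebra = unital_algebra scale
  for scale :: "'f::field \<Rightarrow> 'r::ring_1 \<Rightarrow> 'r" +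
  fixes star :: "'r \<Rightarrow> 'r"
  assumes two_nonzero: "(2::'f) \<noteq> 0"
    and involution: "ring_involution star"
    and first_kind: "first_kind star"
begin

abbreviation S where "S \<equiv> sym_elems star"
abbreviation K where "K \<equiv> skew_elems star"

definition T where "T = K + KSK star"

lemma star_add: "star (x + y) = star x + star y"
  and star_mult: "star (x * y) = star y * star x"
  and star_star [simp]: "star (star x) = x"
  using involution by (auto simp: ring_involution_def)

lemma star_zero [simp]: "star 0 = 0"
  using star_add[of 0 0] by simp

lemma star_minus: "star (- x) = - star x"
  using star_add[of x "- x"] by (simp add: eq_neg_iff_add_eq_0 add.commute)

lemma star_diff: "star (x - y) = star x - star y"
  using star_add[of x "- y"] by (simp add: star_minus)

lemma star_one [simp]: "star 1 = 1"
  using star_mult[of "star 1" 1] by simp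

text \<open>
  The scalars act through the central elements \<open>c \<cdot> 1\<close>, which an involution of the first kind
  fixes. This is what makes \<open>S\<close> and \<open>K\<close> subspaces over \<open>F\<close>.
\<close>
lemma star_scale: "star (scale c x) = scale c (star x)"
proof -
  have "scale c 1 \<in> ring_center"
    by (simp add: ring_center_def scale_mult_left scale_mult_right)
  then have fixed: "star (scale c 1) = scale c 1"
    using first_kind by (auto simp: first_kind_def sym_elems_def)
  have "star (scale c x) = star (scale c 1 * x)"
    by (simp add: scale_mult_left)
  also have "\<dots> = star x * scale c 1"
    by (simp only: star_mult fixed)
  finally show ?thesis
    by (simp add: scale_mult_right)
qed

lemmas star_simps = star_add star_mult star_minus star_diff star_scale

lemma subspace_K: "subspace K"
  by (rule subspaceI) (auto simp: skew_elems_def star_simps)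

lemma subspace_T: "subspace T"
  unfolding T_def KSK_def set_plus_def
  using subspace_sums[OF subspace_K subspace_span] by (rule back_subst[of subspace]) blast

lemmas T_add = subspace_add[OF subspace_T]
  and T_diff = subspace_diff[OF subspace_T]

lemma half_add_half: "scale (1 / 2) (x + x) = x"
proof -
  have "scale (1 / 2) (x + x) = scale (1 / 2 + 1 / 2) x"
    by (simp only: scale_right_distrib scale_left_distrib)
  also have "(1 / 2 + 1 / 2 :: 'f) = 1"
    using two_nonzero by (simp add: field_simps)
  finally show ?thesis by simp
qed

lemma T_half: "x + x \<in> T \<Longrightarrow> x \<in> T"
  using subspace_scale[OF subspace_T, of "x + x" "1 / 2"] by (simp add: half_add_half)

lemma K_in_T: "k \<in> K \<Longrightarrow> k \<in> T"
  unfolding T_def KSK_def using set_plus_intro[OF _ span_zero] by fastforce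

lemma KSK_in_T: "x \<in> KSK star \<Longrightarrow> x \<in> T"
  unfolding T_def using set_plus_intro[OF subspace_0[OF subspace_K]] by fastforce

lemma product_in_KSK: "\<lbrakk>a \<in> K; s \<in> S; b \<in> K\<rbrakk> \<Longrightarrow> a * s * b \<in> KSK star"
  unfolding KSK_def by (rule span_base) blast

lemma KSK_add: "\<lbrakk>x \<in> KSK star; y \<in> KSK star\<rbrakk> \<Longrightarrow> x + y \<in> KSK star"
  and KSK_diff: "\<lbrakk>x \<in> KSK star; y \<in> KSK star\<rbrakk> \<Longrightarrow> x - y \<in> KSK star"
  and KSK_scale: "x \<in> KSK star \<Longrightarrow> scale c x \<in> KSK star"
  unfolding KSK_def by (rule span_add span_diff span_scale; assumption)+

lemma sym_skew_decomposition:
  obtains s k where "s \<in> S" "k \<in> K" "r = s + k"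
proof
  show "scale (1 / 2) (r + star r) \<in> S"
    by (simp add: sym_elems_def star_simps add.commute)
  show "scale (1 / 2) (r - star r) \<in> K"
    by (simp add: skew_elems_def star_simps flip: scale_minus_right)
  have "scale (1 / 2) (r + star r) + scale (1 / 2) (r - star r) = scale (1 / 2) (r + r)"
    by (simp flip: scale_right_distrib)
  then show "r = scale (1 / 2) (r + star r) + scale (1 / 2) (r - star r)"
    by (simp add: half_add_half)
qed

section \<open>Jordan products and commutators\<close>

lemma jordan_S: "\<lbrakk>s \<in> S; t \<in> S\<rbrakk> \<Longrightarrow> s * t + t * s \<in> S"
  and jordan_K: "\<lbrakk>s \<in> S; k \<in> K\<rbrakk> \<Longrightarrow> s * k + k * s \<in> K"
  and lie_S: "\<lbrakk>k \<in> K; s \<in> S\<rbrakk> \<Longrightarrow> k * s - s * k \<in> S"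
  and lie_K: "\<lbrakk>k \<in> K; l \<in> K\<rbrakk> \<Longrightarrow> k * l - l * k \<in> K"
  by (simp_all add: sym_elems_def skew_elems_def star_simps)

text \<open>
  Moving \<open>s\<close> past the outer skew factors of \<open>atb\<close> costs only Jordan products of \<open>s\<close> with \<open>a\<close> and
  \<open>b\<close>, which are skew, and leaves a Jordan product of \<open>s\<close> with \<open>t\<close> in the middle.
\<close>
lemma jordan_KSK:
  assumes s: "s \<in> S" and x: "x \<in> KSK star"
  shows "s * x + x * s \<in> KSK star"
  using x unfolding KSK_def
proof (induction rule: span_induct_alt)
  case base
  then show ?case by (simp add: span_zero)
next
  case (step c p y)
  then obtain a t b where p: "p = a * t * b" and a: "a \<in> K" and t: "t \<in> S" and b: "b \<in> K"
    by blast
  have "s * p + p * s =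
      (s * a + a * s) * t * b + a * t * (s * b + b * s) - a * (s * t + t * s) * b"
    by (simp add: p algebra_simps)
  also have "\<dots> \<in> KSK star"
    by (intro KSK_add KSK_diff product_in_KSK jordan_K jordan_S s a t b)
  finally have "scale c (s * p + p * s) + (s * y + y * s) \<in> KSK star"
    using step.IH by (intro KSK_add[OF KSK_scale]) (simp_all add: KSK_def)
  moreover have "scale c (s * p + p * s) + (s * y + y * s) =
      s * (scale c p + y) + (scale c p + y) * s"
    by (simp add: scale_mult_left scale_mult_right scale_right_distrib algebra_simps)
  ultimately show ?case unfolding KSK_def by simp
qed

text \<open>Commutation with \<open>l\<close> is a derivation which maps \<open>K\<close> to \<open>K\<close> and \<open>S\<close> to \<open>S\<close>.\<close>
lemma lie_KSK:
  assumes l: "l \<in> K" and x: "x \<in> KSK star"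
  shows "l * x - x * l \<in> KSK star"
  using x unfolding KSK_def
proof (induction rule: span_induct_alt)
  case base
  then show ?case by (simp add: span_zero)
next
  case (step c p y)
  then obtain a t b where p: "p = a * t * b" and a: "a \<in> K" and t: "t \<in> S" and b: "b \<in> K"
    by blast
  have "l * p - p * l =
      (l * a - a * l) * t * b + a * (l * t - t * l) * b + a * t * (l * b - b * l)"
    by (simp add: p algebra_simps)
  also have "\<dots> \<in> KSK star"
    by (intro KSK_add product_in_KSK lie_K lie_S l a t b)
  finally have "scale c (l * p - p * l) + (l * y - y * l) \<in> KSK star"
    using step.IH by (intro KSK_add[OF KSK_scale]) (simp_all add: KSK_def)
  moreover have "scale c (l * p - p * l) + (l * y - y * l) =
      l * (scale c p + y) - (scale c p + y) * l"
    by (simp add: scale_mult_left scale_mult_right scale_right_distrib scale_right_diff_distrib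
        algebra_simps)
  ultimately show ?case unfolding KSK_def by simp
qed

lemma jordan_T:
  assumes "s \<in> S" "x \<in> T"
  shows "s * x + x * s \<in> T"
proof -
  obtain k q where "k \<in> K" "q \<in> KSK star" and x: "x = k + q"
    using assms(2) unfolding T_def by (rule set_plus_elim)
  then have "(s * k + k * s) + (s * q + q * s) \<in> T"
    using assms(1) by (intro T_add K_in_T KSK_in_T jordan_K jordan_KSK)
  then show ?thesis by (simp add: x algebra_simps)
qed

lemma lie_T:
  assumes "l \<in> K" "x \<in> T"
  shows "l * x - x * l \<in> T"
proof -
  obtain k q where "k \<in> K" "q \<in> KSK star" and x: "x = k + q"
    using assms(2) unfolding T_def by (rule set_plus_elim)
  then have "(l * k - k * l) + (l * q - q * l) \<in> T"
    using assms(1) by (intro T_add K_in_T KSK_in_T lie_K lie_KSK)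
  then show ?thesis by (simp add: x algebra_simps)
qed

section \<open>Closure under conjugation\<close>

text \<open>
  The Jordan identity \<open>2 sxs = s \<circ> (s \<circ> x) - s\<^sup>2 \<circ> x\<close>, where \<open>x \<circ> y = xy + yx\<close>, reduces the
  quadratic operator to the linear ones.
\<close>
lemma sandwich_S:
  assumes s: "s \<in> S" and x: "x \<in> T"
  shows "s * x * s \<in> T"
proof (rule T_half)
  have ss: "s * s \<in> S"
    using s by (simp add: sym_elems_def star_simps)
  have "s * (s * x + x * s) + (s * x + x * s) * s - (s * s * x + x * (s * s)) \<in> T"
    by (intro T_diff jordan_T s x ss)
  then show "s * x * s + s * x * s \<in> T"
    by (simp add: algebra_simps)
qed

text \<open>Up to a skew summand, which contributes a skew element, \<open>x\<close> may be taken in \<open>S\<close>.\<close>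
lemma sandwich_K:
  assumes k: "k \<in> K"
  shows "k * x * k \<in> T"
proof -
  obtain t l where t: "t \<in> S" and l: "l \<in> K" and x: "x = t + l"
    by (rule sym_skew_decomposition)
  have "k * l * k \<in> K"
    using k l by (simp add: skew_elems_def star_simps mult.assoc)
  then have "k * t * k + k * l * k \<in> T"
    by (intro T_add KSK_in_T product_in_KSK K_in_T k t)
  then show ?thesis by (simp add: x algebra_simps)
qed

text \<open>
  With \<open>B = xks - skx\<close> one has \<open>2B = x \<circ> [k, s] - [k \<circ> s, x]\<close>, and \<open>kxs - sxk\<close> differs from \<open>B\<close> by
  \<open>[k, x] \<circ> s\<close>. Hence the mixed terms of \<open>(s + k) x (s - k)\<close> lie in \<open>T\<close>.
\<close>
lemma sandwich_mixed:
  assumes k: "k \<in> K" and s: "s \<in> S" and x: "x \<in> T"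
  shows "k * x * s - s * x * k \<in> T"
proof -
  have "x * k * s - s * k * x \<in> T"
  proof (rule T_half)
    have "((k * s - s * k) * x + x * (k * s - s * k))
        - ((s * k + k * s) * x - x * (s * k + k * s)) \<in> T"
      by (intro T_diff jordan_T lie_T lie_S jordan_K k s x)
    then show "x * k * s - s * k * x + (x * k * s - s * k * x) \<in> T"
      by (simp add: algebra_simps)
  qed
  then have "(s * (k * x - x * k) + (k * x - x * k) * s) + (x * k * s - s * k * x) \<in> T"
    by (intro T_add jordan_T lie_T k s x)
  then show ?thesis by (simp add: algebra_simps)
qed

lemma conj_closed:
  assumes x: "x \<in> T"
  shows "r * x * star r \<in> T"
proof -
  obtain s k where s: "s \<in> S" and k: "k \<in> K" and r: "r = s + k"
    by (rule sym_skew_decomposition)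
  have star_r: "star r = s - k"
    using s k by (simp add: r star_add sym_elems_def skew_elems_def)
  have "s * x * s + (k * x * s - s * x * k) - k * x * k \<in> T"
    by (intro T_add T_diff sandwich_S sandwich_K sandwich_mixed s k x)
  then show ?thesis
    unfolding star_r by (simp add: r algebra_simps)
qed

section \<open>From conjugation to ideals\<close>

text \<open>
  The sum of \<open>rut\<close> and its adjoint is the polarisation of \<open>r \<mapsto> r u r\<^sup>*\<close> at \<open>r\<close> and \<open>t\<^sup>*\<close>, and their
  difference is skew.
\<close>
lemma ideal_of_symmetric:
  assumes u: "u \<in> T" "u \<in> S"
  shows "r * u * t \<in> T"
proof (rule T_half)
  have "(r + star t) * u * star (r + star t) - r * u * star r - star t * u * star (star t) \<in> T"
    by (intro T_diff conj_closed u)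
  then have "r * u * t + star t * u * star r \<in> T"
    by (simp add: star_add algebra_simps)
  moreover have "r * u * t - star t * u * star r \<in> T"
    using u(2) by (intro K_in_T) (simp add: skew_elems_def sym_elems_def star_simps mult.assoc)
  ultimately have "(r * u * t + star t * u * star r) + (r * u * t - star t * u * star r) \<in> T"
    by (rule T_add)
  then show "r * u * t + r * u * t \<in> T" by simp
qed

text \<open>
  The elements all of whose two-sided multiples lie in \<open>T\<close> form the largest two-sided ideal
  inside \<open>T\<close>, so it suffices to find a nonzero one.
\<close>
lemma T_eq_UNIV:
  assumes simple: "simple_ring TYPE('r)" and u: "u \<in> T" "u \<in> S" "u \<noteq> 0"
  shows "T = UNIV"
proof -
  define I where "I = {x. \<forall>r t. r * x * t \<in> T}"
  have "x - y \<in> I" if "x \<in> I" "y \<in> I" for x y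
    using that T_diff unfolding I_def by (simp add: right_diff_distrib left_diff_distrib)
  moreover have "r * x \<in> I" "x * r \<in> I" if "x \<in> I" for r x
    using that unfolding I_def by (simp_all add: mult.assoc) (simp add: mult.assoc[symmetric])
  moreover have "0 \<in> I"
    unfolding I_def using subspace_0[OF subspace_T] by simp
  ultimately have "two_sided_ideal I"
    unfolding two_sided_ideal_def by blast
  moreover have "u \<in> I"
    unfolding I_def using ideal_of_symmetric u by blast
  ultimately have "I = UNIV"
    using simple u(3) unfolding simple_ring_def by blast
  then have "1 * x * 1 \<in> T" for x
    unfolding I_def by blast
  then show ?thesis by auto
qed

end

theorem theorem3p6:
  fixes scale :: "'f::field \<Rightarrow> 'r::ring_1 \<Rightarrow> 'r"
    and star :: "'r \<Rightarrow> 'r"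
  assumes "CHAR('f) \<noteq> 2"
    and "unital_algebra scale"
    and "simple_ring TYPE('r)"
    and "ring_involution star"
    and "first_kind star"
    and "sym_elems star \<subset> UNIV"
    and "\<not> skew_commutative_set (skew_elems star)"
  shows "(UNIV :: 'r set) = skew_elems star + unital_algebra.KSK scale star"
proof -
  have "(2::'f) \<noteq> 0"
  proof
    assume "(2::'f) = 0"
    then have "of_nat 2 = (0::'f)" by simp
    then have "CHAR('f) dvd 2" by (simp only: of_nat_eq_0_iff_char_dvd)
    moreover have "CHAR('f) \<noteq> 1" by simp
    ultimately show False
      using assms(1) two_is_prime_nat by (metis prime_nat_iff)
  qed
  then interpret first_kind_algebra scale star
    using assms by (simp add: first_kind_algebra_def first_kind_algebra_axioms_def)
  obtain a b where ab: "a \<in> K" "b \<in> K" and neq: "a * b \<noteq> - (b * a)"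
    using assms(7) unfolding skew_commutative_set_def by blast
  have one: "1 \<in> S" by (simp add: sym_elems_def)
  have "a * 1 * b + b * 1 * a \<in> T"
    by (intro KSK_in_T KSK_add product_in_KSK ab one)
  moreover have "a * b + b * a \<in> S"
    using ab by (simp add: sym_elems_def skew_elems_def star_simps add.commute)
  moreover have "a * b + b * a \<noteq> 0"
    using neq by (simp add: eq_neg_iff_add_eq_0)
  ultimately have "T = UNIV"
    using T_eq_UNIV[OF assms(3)] by simp
  then show ?thesis unfolding T_def by simp
qed

end
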